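(* Let $p\in(1,\infty)$, let $q$ satisfy $\frac1p+\frac1q=1$, let $\lambda>0$, let $\mathbf{H}=[\boldsymbol{h}_1\ \cdots\ \boldsymbol{h}_M]^T\in\mathbb{R}^{M\times N}$ be the matrix with rows $\boldsymbol{h}_1^T,\dots,\boldsymbol{h}_M^T$, where $\boldsymbol{h}_1,\dots,\boldsymbol{h}_M\in\mathbb{R}^N$, and let $\boldsymbol{y}\in\mathbb{R}^M$. Let $E:\mathbb{R}^M\times\mathbb{R}^M\to\mathbb{R}^+\cup\{+\infty\}$ be proper, weakly lower-semicontinuous and convex in its second argument. Then the problem $$\min_{\boldsymbol{x}\in\mathbb{R}^N}\left(E\big(\boldsymbol{y},\mathbf{H}\boldsymbol{x}\big)+\lambda\|\boldsymbol{x}\|_{\ell_p}^p\right)$$ has a unique solution $\boldsymbol{s}\in\mathbb{R}^N$, irrespective of $M$ and $\mathbf{H}$, and this solution can be represented as $$[\boldsymbol{s}]_n=\frac{\big|[\mathbf{H}^T\boldsymbol{a}]_n\big|^{q-1}}{\|\mathbf{H}^T\boldsymbol{a}\|_{\ell_q}^{q-2}}\,\mathrm{sign}\big([\mathbf{H}^T\boldsymbol{a}]_n\big),\qquad n=1,\dots,N,$$ for a suitable value of the (data-dependent) parameter vector $\boldsymbol{a}\in\mathbb{R}^M$. In particular, for $p=2$, $\boldsymbol{s}=\mathbf{H}^T\boldsymbol{a}=\sum_{m=1}^M a_m\boldsymbol{h}_m$, so that $\boldsymbol{s}\in\mathrm{span}\{\boldsymbol{h}_m\}_{m=1}^M$.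
   Context: Here $\mathbb{R}^+=[0,\infty)$, $\|\boldsymbol{x}\|_{\ell_p}=\big(\sum_{n=1}^N|x_n|^p\big)^{1/p}$ (and likewise for $q$), $[\boldsymbol{x}]_n$ denotes the $n$th component of the vector $\boldsymbol{x}$, and $a_m$ is the $m$th component of $\boldsymbol{a}$. The right-hand side of the formula is the duality map from $(\mathbb{R}^N,\|\cdot\|_{\ell_q})$ to its dual $(\mathbb{R}^N,\|\cdot\|_{\ell_p})$ evaluated at $\mathbf{H}^T\boldsymbol{a}$, i.e., the unique vector $\boldsymbol{s}$ with $\|\boldsymbol{s}\|_{\ell_p}=\|\mathbf{H}^T\boldsymbol{a}\|_{\ell_q}$ and $\boldsymbol{s}^T\mathbf{H}^T\boldsymbol{a}=\|\boldsymbol{s}\|_{\ell_p}\|\mathbf{H}^T\boldsymbol{a}\|_{\ell_q}$; it is $\boldsymbol{0}$ when $\mathbf{H}^T\boldsymbol{a}=\boldsymbol{0}$.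
   Formalization: The formal theorem additionally assumes that E(y,Hx) is finite for some x; without this (e.g. H=0 and E(y,·) the indicator of {1}) the objective is identically +∞ and the solution is not unique. *)

theory Defs
  imports "HOL-Analysis.Analysis"
begin

definition lp_norm :: "real \<Rightarrow> real ^ 'n \<Rightarrow> real" where
  "lp_norm p x = (\<Sum>n\<in>UNIV. \<bar>x $ n\<bar> powr p) powr (1 / p)"

text \<open>
  For $q > 1$ the quotient
  \<open>\<bar>u $ n\<bar> powr (q - 1) / lp_norm q u powr (q - 2) * sgn (u $ n)\<close> (the duality map of $\ell_q$) is $0/0$
  at $u = 0$, which HOL evaluates to $0$ as required; this includes $q = 2$, since \<open>0 powr 0 = 0\<close>.
\<close>

text \<open>
  Functions with values in $[0,\infty]$ are modelled by the type \<^typ>\<open>ennreal\<close>, in which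
  $0 \cdot \infty = 0$; the value $-\infty$ is excluded by the type.
\<close>

text \<open>
  The problem is posed with both \<open>E y\<close> and the data term \<open>\<lambda>x. E y (H *v x)\<close> proper: if the range
  of \<open>H\<close> misses the domain of \<open>E y\<close>, the cost is identically $\infty$ and uniqueness fails.
\<close>

definition proper_fun :: "('a \<Rightarrow> ennreal) \<Rightarrow> bool" where
  "proper_fun f \<longleftrightarrow> (\<exists>x. f x \<noteq> \<infinity>)"

definition convex_fun :: "('a::real_vector \<Rightarrow> ennreal) \<Rightarrow> bool" where
  "convex_fun f \<longleftrightarrow> (\<forall>x z t. 0 \<le> t \<and> t \<le> 1 \<longrightarrow>
     f ((1 - t) *\<^sub>R x + t *\<^sub>R z) \<le> ennreal (1 - t) * f x + ennreal t * f z)"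

text \<open>The initial topology of all continuous linear functionals.\<close>

definition weak_topology :: "'a::real_normed_vector topology" where
  "weak_topology = topology_generated_by
     {\<phi> -` U |\<phi> U. bounded_linear (\<phi> :: 'a \<Rightarrow> real) \<and> open U}"

definition weakly_lsc :: "('a::real_normed_vector \<Rightarrow> ennreal) \<Rightarrow> bool" where
  "weakly_lsc f \<longleftrightarrow> (\<forall>c. openin weak_topology {x. c < f x})"

definition regularized_cost ::
    "(real ^ 'm \<Rightarrow> real ^ 'm \<Rightarrow> ennreal) \<Rightarrow> real ^ 'm \<Rightarrow> real ^ 'n ^ 'm \<Rightarrow> real \<Rightarrow> real
      \<Rightarrow> real ^ 'n \<Rightarrow> ennreal" where
  "regularized_cost E y H lam p x = E y (H *v x) + ennreal (lam * lp_norm p x powr p)"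

end

theory Submission
  imports Defs
begin

text \<open>
  Existence is the direct method: the cost is lower semicontinuous with compact sublevel sets.
  Uniqueness comes from the strict convexity of \<open>\<lambda>x. \<bar>x\<bar> powr p\<close>. For the representation, a
  perturbation of the minimizer \<open>s\<close> inside the kernel of \<open>H\<close> leaves the data term unchanged, so
  \<open>s\<close> minimizes \<open>\<Sum>n. \<bar>s $ n\<bar> powr p\<close> on \<open>s + ker H\<close>. Hence the gradient of this sum is orthogonal
  to the kernel of \<open>H\<close>, i.e. it lies in the range of the transpose of \<open>H\<close>, and inverting the
  gradient map gives the formula; no subdifferential calculus for the data term is involved.
\<close>

section \<open>Lower semicontinuity and attained minima\<close>

text \<open>The generating sets are preimages of open sets under norm-continuous functionals. This
  turns weak lower semicontinuity into openness of the superlevel sets in the norm topology.\<close>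

lemma open_if_openin_weak_topology:
  assumes "openin weak_topology (U :: 'a::real_normed_vector set)"
  shows "open U"
proof -
  have "generate_topology_on {\<phi> -` V |\<phi> V. bounded_linear (\<phi> :: 'a \<Rightarrow> real) \<and> open V} U"
    using assms by (simp add: weak_topology_def openin_topology_generated_by_iff)
  then show ?thesis
  proof induction
    case (Basis s)
    then obtain \<phi> V where "s = \<phi> -` V" "bounded_linear (\<phi> :: 'a \<Rightarrow> real)" "open V" by blast
    then show ?case
      using open_vimage[OF \<open>open V\<close>] linear_continuous_on by blast
  qed auto
qed

text \<open>Without a minimizer, the superlevel sets above the values at points of \<open>S\<close>
  cover \<open>S\<close>. Among the finitely many points indexing a subcover, one of least value is
  left uncovered.\<close>

lemma compact_lsc_attains_inf:
  fixes f :: "'a::topological_space \<Rightarrow> 'b::linorder"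
  assumes "compact S" "S \<noteq> {}" and lsc: "\<And>c. open {x. c < f x}"
  shows "\<exists>x\<in>S. \<forall>z\<in>S. f x \<le> f z"
proof (rule ccontr)
  assume "\<not> ?thesis"
  then have "S \<subseteq> (\<Union>z\<in>S. {x. f z < f x})"
    by (auto simp: not_le)
  then obtain T where T: "T \<subseteq> S" "finite T" "S \<subseteq> (\<Union>z\<in>T. {x. f z < f x})"
    using compactE_image[OF \<open>compact S\<close>, of S "\<lambda>z. {x. f z < f x}"] lsc by metis
  with \<open>S \<noteq> {}\<close> have "T \<noteq> {}" by auto
  then have "Min (f ` T) \<in> f ` T" using \<open>finite T\<close> by simp
  then obtain z where z: "z \<in> T" "f z = Min (f ` T)" by force
  then have "f z \<le> f w" if "w \<in> T" for w
    using that \<open>finite T\<close> by simp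
  moreover obtain w where "w \<in> T" "f w < f z"
    using z T by blast
  ultimately show False by (simp add: leD)
qed

text \<open>A level \<open>b\<close> interposed between \<open>c - g x\<close> and
  \<open>f x\<close> writes the superlevel set of the sum as a union of open sets.\<close>

lemma open_less_add_ennreal:
  fixes f g :: "'a::topological_space \<Rightarrow> ennreal"
  assumes f: "\<And>c. open {x. c < f x}" and g: "continuous_on UNIV g"
  shows "open {x. c < f x + g x}"
proof -
  \<comment> \<open>The set \<open>{x. c < g x}\<close> stands apart because no \<open>b\<close>
    lies below \<open>f x\<close> when \<open>f x = 0\<close>.\<close>
  have "{x. c < f x + g x} = {x. c < g x} \<union> (\<Union>b. {x. b < f x} \<inter> {x. c < b + g x})"
  proof (intro set_eqI iffI)
    fix x assume x: "x \<in> {x. c < f x + g x}"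
    show "x \<in> {x. c < g x} \<union> (\<Union>b. {x. b < f x} \<inter> {x. c < b + g x})"
    proof (cases "c < g x")
      case False
      then have le: "g x \<le> c" by simp
      moreover have "c < top" using x by (auto intro: less_le_trans)
      ultimately have fin: "g x < top" by (rule le_less_trans)
      have "c - g x < f x"
        using x by (simp add: minus_less_iff_ennreal[OF fin le])
      then obtain b where b: "c - g x < b" "b < f x" using dense by blast
      then have "c < b + g x"
        by (simp add: minus_less_iff_ennreal[OF fin le])
      with b show ?thesis by auto
    qed simp
  next
    fix x assume "x \<in> {x. c < g x} \<union> (\<Union>b. {x. b < f x} \<inter> {x. c < b + g x})"
    then show "x \<in> {x. c < f x + g x}"
      by (auto elim!: less_le_trans intro: add_right_mono add_increasing less_imp_le)
  qed
  moreover have "open {x. d < b + g x}" for b d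
    by (intro open_Collect_less continuous_intros g)
  moreover have "open {x. c < g x}"
    by (intro open_Collect_less continuous_intros g)
  ultimately show ?thesis
    using f by (auto intro!: open_Un open_UN open_Int)
qed

section \<open>Derivative and strict convexity of the scalar power\<close>

text \<open>On each open half-line this is the usual power rule; at zero the difference quotient has
  absolute value \<open>\<bar>h\<bar> powr (p - 1)\<close>, which tends to 0 because
  \<open>1 < p\<close>.\<close>

lemma has_real_derivative_abs_powr:
  fixes x p :: real
  assumes "1 < p"
  shows "((\<lambda>x. \<bar>x\<bar> powr p) has_real_derivative p * \<bar>x\<bar> powr (p - 1) * sgn x) (at x)"
proof -
  consider "x > 0" | "x < 0" | "x = 0" by linarith
  then show ?thesis
  proof cases
    case 1
    have "((\<lambda>x. x powr p) has_real_derivative p * \<bar>x\<bar> powr (p - 1) * sgn x) (at x)"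
      using has_real_derivative_powr[OF 1, of p] 1 by simp
    then show ?thesis
      by (rule has_field_derivative_transform_within_open[where S = "{0<..}"]) (use 1 in auto)
  next
    case 2
    have "((\<lambda>x. (-x) powr p) has_real_derivative p * (-x) powr (p - 1) * (-1)) (at x)"
      using 2 by (intro DERIV_chain2[where f = "\<lambda>x. x powr p"] has_real_derivative_powr) 
        (auto intro!: derivative_eq_intros)
    then have "((\<lambda>x. (-x) powr p) has_real_derivative p * \<bar>x\<bar> powr (p - 1) * sgn x) (at x)"
      using 2 by simp
    then show ?thesis
      by (rule has_field_derivative_transform_within_open[where S = "{..<0}"]) (use 2 in auto)
  next
    case 3
    have "((\<lambda>h::real. \<bar>h\<bar> powr (p - 1)) \<longlongrightarrow> 0) (at 0)"
      using assms by (auto intro!: tendsto_eq_intros)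
    moreover have "\<bar>\<bar>h\<bar> powr p / h\<bar> = \<bar>h\<bar> powr (p - 1)" for h :: real
      by (cases "h = 0") (auto simp: powr_diff abs_divide)
    ultimately have "((\<lambda>h::real. \<bar>h\<bar> powr p / h) \<longlongrightarrow> 0) (at 0)"
      by (subst tendsto_rabs_zero_iff[symmetric]) simp
    then show ?thesis
      using 3 by (simp add: has_field_derivative_iff)
  qed
qed

text \<open>For \<open>r = p - 1\<close> this is, up to the factor \<open>p\<close>, the derivative
  of the scalar power; its strict growth is the source of strict convexity.\<close>

lemma abs_powr_sgn_strict_mono:
  fixes x y r :: real
  assumes "0 < r" "x < y"
  shows "\<bar>x\<bar> powr r * sgn x < \<bar>y\<bar> powr r * sgn y"
proof -
  consider "y < 0" | "x < 0" "0 \<le> y" | "0 \<le> x" by linarith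
  then show ?thesis
  proof cases
    case 1
    then have "\<bar>y\<bar> powr r < \<bar>x\<bar> powr r"
      using assms by (intro powr_less_mono2) auto
    then show ?thesis using 1 assms by simp
  next
    case 2
    then have "\<bar>x\<bar> powr r * sgn x < 0" "0 \<le> \<bar>y\<bar> powr r * sgn y"
      by (auto simp: sgn_if)
    then show ?thesis by linarith
  next
    case 3
    then have "\<bar>x\<bar> powr r < \<bar>y\<bar> powr r"
      using assms by (intro powr_less_mono2) auto
    then show ?thesis using 3 assms by (cases "x = 0") auto
  qed
qed

text \<open>By the mean value theorem the slope of the chord is the derivative at a point strictly
  between \<open>x\<close> and \<open>y\<close>, and the derivative is strictly increasing.\<close>

lemma abs_powr_above_tangent:
  fixes x y p :: real
  assumes p: "1 < p" and "x \<noteq> y"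
  shows "\<bar>x\<bar> powr p + p * \<bar>x\<bar> powr (p - 1) * sgn x * (y - x) < \<bar>y\<bar> powr p"
proof (cases "x < y")
  case True
  then obtain z where z: "x < z" "z < y"
    "\<bar>y\<bar> powr p - \<bar>x\<bar> powr p = (y - x) * (p * \<bar>z\<bar> powr (p - 1) * sgn z)"
    using MVT2[OF True has_real_derivative_abs_powr[OF p]] by blast
  have "p * (\<bar>x\<bar> powr (p - 1) * sgn x) < p * (\<bar>z\<bar> powr (p - 1) * sgn z)"
    using abs_powr_sgn_strict_mono[of "p - 1" x z] z p by simp
  then have "(y - x) * (p * (\<bar>x\<bar> powr (p - 1) * sgn x)) < (y - x) * (p * (\<bar>z\<bar> powr (p - 1) * sgn z))"
    using True by simp
  then show ?thesis using z by (simp add: algebra_simps)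
next
  case False
  then have "y < x" using assms by simp
  then obtain z where z: "y < z" "z < x"
    "\<bar>x\<bar> powr p - \<bar>y\<bar> powr p = (x - y) * (p * \<bar>z\<bar> powr (p - 1) * sgn z)"
    using MVT2[OF \<open>y < x\<close> has_real_derivative_abs_powr[OF p]] by blast
  have "p * (\<bar>z\<bar> powr (p - 1) * sgn z) < p * (\<bar>x\<bar> powr (p - 1) * sgn x)"
    using abs_powr_sgn_strict_mono[of "p - 1" z x] z p by simp
  then have "(x - y) * (p * (\<bar>z\<bar> powr (p - 1) * sgn z)) < (x - y) * (p * (\<bar>x\<bar> powr (p - 1) * sgn x))"
    using \<open>y < x\<close> by simp
  then show ?thesis using z by (simp add: algebra_simps)
qed

text \<open>The tangent at the midpoint lies strictly below the graph at both ends; adding the two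
  inequalities cancels the slope terms.\<close>

lemma abs_powr_midpoint_less:
  fixes x y p :: real
  assumes "1 < p" "x \<noteq> y"
  shows "\<bar>(x + y) / 2\<bar> powr p < (\<bar>x\<bar> powr p + \<bar>y\<bar> powr p) / 2"
  using abs_powr_above_tangent[of p "(x + y) / 2" x] abs_powr_above_tangent[of p "(x + y) / 2" y] assms
  by (simp add: field_simps)

section \<open>Strict convexity and coercivity of the penalty\<close>

lemma lp_norm_powr:
  assumes "0 < p"
  shows "lp_norm p x powr p = (\<Sum>n\<in>UNIV. \<bar>x $ n\<bar> powr p)"
  using assms by (simp add: lp_norm_def powr_powr sum_nonneg)

lemma lp_norm_powr_midpoint_less:
  fixes x z :: "real ^ 'n"
  assumes "1 < p" "x \<noteq> z"
  shows "lp_norm p ((1/2) *\<^sub>R x + (1/2) *\<^sub>R z) powr p < (lp_norm p x powr p + lp_norm p z powr p) / 2"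
proof -
  let ?m = "\<lambda>n. \<bar>(x $ n + z $ n) / 2\<bar> powr p"
  let ?r = "\<lambda>n. (\<bar>x $ n\<bar> powr p + \<bar>z $ n\<bar> powr p) / 2"
  from \<open>x \<noteq> z\<close> obtain k where k: "x $ k \<noteq> z $ k" by (auto simp: vec_eq_iff)
  have "sum ?m UNIV < sum ?r UNIV"
  proof (rule sum_strict_mono_ex1)
    show "\<forall>n\<in>UNIV. ?m n \<le> ?r n"
    proof
      fix n show "?m n \<le> ?r n"
        using abs_powr_midpoint_less[of p "x $ n" "z $ n"] assms
        by (cases "x $ n = z $ n") auto
    qed
    show "\<exists>n\<in>UNIV. ?m n < ?r n"
      using abs_powr_midpoint_less[OF _ k] assms by blast
  qed simp
  then show ?thesis
    using assms by (simp add: lp_norm_powr sum.distrib flip: sum_divide_distrib add_divide_distrib)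
qed

text \<open>Coercivity of the penalty, which makes the sublevel sets of the cost bounded. It comes
  from a crude bound in each coordinate, summed through the l1 norm.\<close>

lemma norm_le_lp_norm_powr:
  fixes x :: "real ^ 'n"
  assumes "1 < p"
  shows "norm x \<le> CARD('n) + lp_norm p x powr p"
proof -
  have "\<bar>t\<bar> \<le> 1 + \<bar>t\<bar> powr p" for t :: real
  proof (cases "\<bar>t\<bar> \<le> 1")
    case False
    then have "\<bar>t\<bar> powr 1 \<le> \<bar>t\<bar> powr p"
      using assms by (intro powr_mono) auto
    then show ?thesis using False by simp
  qed (simp add: add_increasing2)
  then have "(\<Sum>n\<in>UNIV. \<bar>x $ n\<bar>) \<le> (\<Sum>n\<in>UNIV. 1 + \<bar>x $ n\<bar> powr p)"
    by (intro sum_mono)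
  then show ?thesis
    using norm_le_l1_cart[of x] assms by (simp add: lp_norm_powr sum.distrib)
qed

section \<open>Orthogonality to the kernel and the duality map\<close>

text \<open>The component \<open>v\<close> of \<open>g\<close> orthogonal to the range of the
  transpose lies in the kernel of \<open>H\<close>, so it is orthogonal to \<open>g\<close> and
  hence to itself.\<close>

lemma in_range_transpose_if_orthogonal_kernel:
  fixes H :: "real ^ 'n ^ 'm"
  assumes "\<And>v. H *v v = 0 \<Longrightarrow> g \<bullet> v = 0"
  shows "\<exists>b. g = transpose H *v b"
proof -
  let ?R = "range ((*v) (transpose H))"
  have sub: "subspace ?R"
    by (intro linear_subspace_image) auto
  obtain u v where u: "u \<in> span ?R" and v: "\<And>w. w \<in> span ?R \<Longrightarrow> orthogonal v w" and g: "g = u + v"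
    using orthogonal_subspace_decomp_exists[of ?R g] by metis
  have u': "u \<in> ?R" using u sub by (metis span_eq_iff)
  have "v \<bullet> (transpose H *v b) = 0" for b
    using v[of "transpose H *v b"] by (auto simp: orthogonal_def intro: span_base)
  then have "(H *v v) \<bullet> b = 0" for b
    by (metis dot_lmul_matrix inner_commute transpose_matrix_vector)
  then have "H *v v = 0"
    using inner_eq_zero_iff by blast
  then have "g \<bullet> v = 0" by (rule assms)
  moreover have "v \<bullet> u = 0" using v[OF u] by (simp add: orthogonal_def)
  ultimately have "v = 0"
    by (simp add: g inner_add_right inner_commute)
  then show ?thesis using u' g by auto
qed

text \<open>Along the line through \<open>s\<close> in direction \<open>v\<close> the sum has a
  minimum at \<open>t = 0\<close>, and its derivative there is \<open>p\<close> times the inner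
  product.\<close>

lemma abs_powr_gradient_orthogonal_if_minimal:
  fixes s v :: "real ^ 'n"
  assumes p: "1 < p"
    and min: "\<And>t. (\<Sum>n\<in>UNIV. \<bar>s $ n\<bar> powr p) \<le> (\<Sum>n\<in>UNIV. \<bar>s $ n + t * v $ n\<bar> powr p)"
  shows "(\<chi> n. \<bar>s $ n\<bar> powr (p - 1) * sgn (s $ n)) \<bullet> v = 0"
proof -
  let ?f = "\<lambda>t. \<Sum>n\<in>UNIV. \<bar>s $ n + t * v $ n\<bar> powr p"
  let ?D = "\<Sum>n\<in>UNIV. (p * \<bar>s $ n\<bar> powr (p - 1) * sgn (s $ n)) * v $ n"
  have "((\<lambda>t. \<bar>s $ n + t * v $ n\<bar> powr p) has_real_derivative
          (p * \<bar>s $ n\<bar> powr (p - 1) * sgn (s $ n)) * v $ n) (at 0)" for n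
    by (rule DERIV_chain2[where f = "\<lambda>x. \<bar>x\<bar> powr p"])
      (use has_real_derivative_abs_powr[OF p, of "s $ n"] in \<open>auto intro!: derivative_eq_intros\<close>)
  then have "(?f has_real_derivative ?D) (at 0)"
    by (intro DERIV_sum) auto
  then have "?D = 0"
    by (rule DERIV_local_min[where d = 1]) (use min in auto)
  moreover have "?D = p * ((\<chi> n. \<bar>s $ n\<bar> powr (p - 1) * sgn (s $ n)) \<bullet> v)"
    by (simp add: inner_vec_def sum_distrib_left mult_ac)
  ultimately show ?thesis using p by simp
qed

lemma lp_norm_scaleR:
  assumes "0 < p" "0 \<le> c"
  shows "lp_norm p (c *\<^sub>R x) = c * lp_norm p x"
  using assms
  by (simp add: lp_norm_def abs_mult powr_mult sum_nonneg powr_powr flip: sum_distrib_left)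

lemma lp_norm_pos:
  assumes "x \<noteq> 0"
  shows "0 < lp_norm p x"
proof -
  obtain k where "x $ k \<noteq> 0" using assms by (auto simp: vec_eq_iff)
  then have "0 < (\<Sum>n\<in>UNIV. \<bar>x $ n\<bar> powr p)"
    by (intro sum_pos2[of _ k]) auto
  then show ?thesis by (simp add: lp_norm_def)
qed

text \<open>As \<open>(p - 1) * (q - 1) = 1\<close>, raising to the power \<open>q - 1\<close> with
  the sign kept recovers \<open>s\<close> from \<open>g\<close>. The duality map also divides by a
  power of the norm; the factor in \<open>u\<close> is chosen so that its power \<open>q - 1\<close>
  cancels that denominator exactly.\<close>

lemma duality_map_scaled_gradient:
  fixes s g :: "real ^ 'n"
  assumes p: "1 < p" and q: "1 / p + 1 / q = 1"
    and g: "g = (\<chi> n. \<bar>s $ n\<bar> powr (p - 1) * sgn (s $ n))"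
    and u: "u = lp_norm q g powr (q - 2) *\<^sub>R g"
  shows "s $ n = \<bar>u $ n\<bar> powr (q - 1) / lp_norm q u powr (q - 2) * sgn (u $ n)"
proof (cases "g = 0")
  case True
  then have "g $ n = 0" by simp
  then have "s $ n = 0" by (simp add: g sgn_if split: if_splits)
  then show ?thesis using True by (simp add: u)
next
  case False
  define L where "L = lp_norm q g"
  define c where "c = L powr (q - 2)"
  \<comment> \<open>Since \<open>1 / 0 = 0\<close>, the value \<open>q = 0\<close> would force
    \<open>p = 1\<close>; it is excluded first.\<close>
  have q_eq: "q = p / (p - 1)"
    using p q by (cases "q = 0") (auto simp: field_simps)
  have "q > 0" and pq: "(p - 1) * (q - 1) = 1"
    using p by (simp_all add: q_eq field_simps)
  have L: "0 < L" unfolding L_def using False by (rule lp_norm_pos)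
  then have c: "0 < c" by (simp add: c_def)
  have lpu: "lp_norm q u = c * L"
    using \<open>q > 0\<close> c by (simp add: u c_def L_def lp_norm_scaleR)
  have "u = c *\<^sub>R g" by (simp add: u c_def L_def)
  then have un: "u $ n = c * (\<bar>s $ n\<bar> powr (p - 1) * sgn (s $ n))" by (simp add: g)
  have "\<bar>u $ n\<bar> = c * \<bar>s $ n\<bar> powr (p - 1)"
    using c by (auto simp: un abs_mult sgn_if)
  then have abs_u: "\<bar>u $ n\<bar> powr (q - 1) = c powr (q - 1) * \<bar>s $ n\<bar>"
    using c by (simp add: powr_mult powr_powr pq)
  have sgn_u: "sgn (u $ n) = sgn (s $ n)"
    using c by (cases "s $ n = 0") (simp_all add: un sgn_mult)
  have "c powr (q - 1) = c powr (q - 2) * c"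
    using c powr_add[of c "q - 2" 1] by simp
  then have "c powr (q - 1) / (c * L) powr (q - 2) = 1"
    using c L by (simp add: powr_mult flip: c_def)
  then have "\<bar>u $ n\<bar> powr (q - 1) / lp_norm q u powr (q - 2) * sgn (u $ n) = \<bar>s $ n\<bar> * sgn (s $ n)"
    by (simp add: abs_u sgn_u lpu)
  then show ?thesis by (simp add: abs_sgn[symmetric] abs_mult_sgn)
qed

section \<open>Minimizers of the regularized cost\<close>

lemma regularized_cost_lsc:
  assumes "weakly_lsc (E y)" "1 < p"
  shows "open {x. c < regularized_cost E y H lam p x}"
proof -
  have "open {x. c < E y (H *v x)}" for c
  proof -
    have "open ((*v) H -` {z. c < E y z})"
      using assms(1) unfolding weakly_lsc_def
      by (intro open_vimage open_if_openin_weak_topology matrix_vector_mult_linear_continuous_on) auto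
    then show ?thesis by (simp add: vimage_def)
  qed
  moreover have "continuous_on UNIV (\<lambda>x. ennreal (lam * lp_norm p x powr p))"
    unfolding lp_norm_powr[OF less_trans[OF zero_less_one \<open>1 < p\<close>]]
    by (intro continuous_on_ennreal continuous_on_mult_left continuous_on_sum continuous_on_powr'
        continuous_intros) (use \<open>1 < p\<close> in auto)
  ultimately show ?thesis
    unfolding regularized_cost_def by (rule open_less_add_ennreal)
qed

text \<open>The sublevel set at a feasible point is closed by lower semicontinuity and bounded by
  coercivity, so the cost attains its minimum on it.\<close>

lemma regularized_cost_attains_min:
  fixes H :: "real ^ 'n ^ 'm"
  assumes p: "1 < p" and lam: "0 < lam" and lsc: "weakly_lsc (E y)"
    and feasible: "proper_fun (\<lambda>x. E y (H *v x))"
  shows "\<exists>s. \<forall>z. regularized_cost E y H lam p s \<le> regularized_cost E y H lam p z"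
proof -
  let ?F = "regularized_cost E y H lam p"
  obtain x0 where "E y (H *v x0) \<noteq> \<infinity>" using feasible by (auto simp: proper_fun_def)
  then have "?F x0 \<noteq> top" by (simp add: regularized_cost_def)
  then obtain K where K: "0 \<le> K" "?F x0 = ennreal K" by (cases "?F x0") auto
  let ?C = "{x. ?F x \<le> ?F x0}"
  have "norm x \<le> CARD('n) + K / lam" if "x \<in> ?C" for x
  proof -
    have "ennreal (lam * lp_norm p x powr p) \<le> ?F x"
      by (simp add: regularized_cost_def add_increasing)
    also have "\<dots> \<le> ennreal K" using that K by simp
    finally have "lp_norm p x powr p \<le> K / lam"
      using K lam by (simp add: field_simps)
    then show ?thesis using norm_le_lp_norm_powr[OF p, of x] by simp
  qed
  then have "bounded ?C" by (auto intro: boundedI)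
  moreover have "?C = - {x. ?F x0 < ?F x}" by auto
  then have "closed ?C"
    using regularized_cost_lsc[of E y p] lsc p by (simp add: closed_def)
  ultimately have "compact ?C" by (simp add: compact_eq_bounded_closed)
  moreover have "x0 \<in> ?C" by simp
  ultimately obtain s where "?F s \<le> ?F x0" "\<And>z. ?F z \<le> ?F x0 \<Longrightarrow> ?F s \<le> ?F z"
    using compact_lsc_attains_inf[of ?C ?F] regularized_cost_lsc[of E y p] lsc p by blast
  \<comment> \<open>Outside \<open>?C\<close> the cost exceeds \<open>?F x0\<close>, hence also
    \<open>?F s\<close>.\<close>
  then show ?thesis by (meson linear order_trans)
qed

text \<open>The midpoint of two distinct minimizers would cost less: its data term is at most the
  average and its penalty is strictly below the average. Finiteness of the minimal value lets the
  comparison take place in the reals.\<close>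

lemma regularized_cost_min_unique:
  fixes s s' :: "real ^ 'n" and H :: "real ^ 'n ^ 'm"
  assumes p: "1 < p" and lam: "0 < lam" and conv: "convex_fun (E y)"
    and finite: "regularized_cost E y H lam p s \<noteq> top"
    and s: "\<And>z. regularized_cost E y H lam p s \<le> regularized_cost E y H lam p z"
    and s': "\<And>z. regularized_cost E y H lam p s' \<le> regularized_cost E y H lam p z"
  shows "s = s'"
proof (rule ccontr)
  assume "s \<noteq> s'"
  let ?F = "regularized_cost E y H lam p"
  let ?R = "\<lambda>x :: real ^ 'n. lp_norm p x powr p"
  let ?m = "(1/2) *\<^sub>R s + (1/2) *\<^sub>R s'"
  have eq: "?F s = ?F s'" using s s' by (simp add: antisym)
  obtain a where a: "0 \<le> a" "E y (H *v s) = ennreal a"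
    using finite by (cases "E y (H *v s)") (auto simp: regularized_cost_def)
  obtain b where b: "0 \<le> b" "E y (H *v s') = ennreal b"
    using finite eq by (cases "E y (H *v s')") (auto simp: regularized_cost_def)
  have Fs: "?F s = ennreal (a + lam * ?R s)" and Fs': "?F s' = ennreal (b + lam * ?R s')"
    using a b lam by (simp_all add: regularized_cost_def)
  then have ab: "a + lam * ?R s = b + lam * ?R s'"
    using eq a b lam
    by (metis ennreal_inj add_nonneg_nonneg mult_nonneg_nonneg less_imp_le powr_ge_zero)
  have "E y (H *v ?m) = E y ((1 - 1/2) *\<^sub>R (H *v s) + (1/2) *\<^sub>R (H *v s'))"
    by (simp add: matrix_vector_right_distrib matrix_vector_mult_scaleR)
  also have "\<dots> \<le> ennreal (1 - 1/2) * ennreal a + ennreal (1/2) * ennreal b"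
    unfolding a(2)[symmetric] b(2)[symmetric]
    using conv[unfolded convex_fun_def, rule_format, of "1/2"] by simp
  also have "\<dots> = ennreal ((1 - 1/2) * a + 1/2 * b)"
  proof -
    have "ennreal t * ennreal a + ennreal t' * ennreal b = ennreal (t * a + t' * b)"
      if "0 \<le> t" "0 \<le> t'" for t t'
      using that a b by (simp add: ennreal_mult)
    from this[of "1 - 1/2" "1/2"] show ?thesis by simp
  qed
  also have "\<dots> = ennreal ((a + b) / 2)"
    by (rule arg_cong[where f = ennreal]) (simp add: field_simps)
  finally have "?F ?m \<le> ennreal ((a + b) / 2) + ennreal (lam * ?R ?m)"
    by (simp add: regularized_cost_def add_right_mono)
  also have "\<dots> = ennreal ((a + b) / 2 + lam * ?R ?m)"
    using a b lam by simp
  also have "\<dots> < ennreal (a + lam * ?R s)"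
  proof -
    have "lam * ?R ?m < lam * ((?R s + ?R s') / 2)"
      using lp_norm_powr_midpoint_less[OF p \<open>s \<noteq> s'\<close>] lam by simp
    also have "\<dots> = (lam * ?R s + lam * ?R s') / 2" by (simp add: algebra_simps)
    \<comment> \<open>By \<open>ab\<close> the average of the two costs equals the cost of
      \<open>s\<close>.\<close>
    finally have "(a + b) / 2 + lam * ?R ?m < a + lam * ?R s"
      using ab by (simp add: field_simps)
    then show ?thesis using a b lam by (intro ennreal_lessI) (auto intro: le_less_trans[rotated])
  qed
  finally show False using s[of ?m] Fs by simp
qed

text \<open>First-order optimality: up to a scalar factor, \<open>b\<close> is a Lagrange multiplier
  for minimizing the penalty with \<open>H *v x\<close> held fixed.\<close>

lemma regularized_cost_min_gradient:
  fixes H :: "real ^ 'n ^ 'm"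
  assumes p: "1 < p" and lam: "0 < lam"
    and finite: "regularized_cost E y H lam p s \<noteq> top"
    and s: "\<And>z. regularized_cost E y H lam p s \<le> regularized_cost E y H lam p z"
  shows "\<exists>b. (\<chi> n. \<bar>s $ n\<bar> powr (p - 1) * sgn (s $ n)) = transpose H *v b"
proof (intro in_range_transpose_if_orthogonal_kernel abs_powr_gradient_orthogonal_if_minimal p)
  fix v t assume "H *v v = 0"
  then have "H *v (s + t *\<^sub>R v) = H *v s"
    by (simp add: matrix_vector_right_distrib matrix_vector_mult_scaleR)
  \<comment> \<open>Finiteness is what allows the equal data terms to be cancelled in
    \<open>ennreal\<close>.\<close>
  moreover have "E y (H *v s) \<noteq> top"
    using finite by (auto simp: regularized_cost_def)
  ultimately have "ennreal (lam * lp_norm p s powr p) \<le> ennreal (lam * lp_norm p (s + t *\<^sub>R v) powr p)"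
    using s[of "s + t *\<^sub>R v"] by (simp add: regularized_cost_def ennreal_add_left_cancel_le)
  then show "(\<Sum>n\<in>UNIV. \<bar>s $ n\<bar> powr p) \<le> (\<Sum>n\<in>UNIV. \<bar>s $ n + t * v $ n\<bar> powr p)"
    using lam p by (simp add: lp_norm_powr sum_nonneg)
qed


theorem mainTheorem2:
  fixes p q lam :: real
    and h :: "'m::finite \<Rightarrow> real ^ 'n::finite"
    and H :: "real ^ 'n ^ 'm"
    and y :: "real ^ 'm"
    and E :: "real ^ 'm \<Rightarrow> real ^ 'm \<Rightarrow> ennreal"
  assumes p: "1 < p"
    and q: "1 / p + 1 / q = 1"
    and lam: "0 < lam"
    and H: "H = (\<chi> m. h m)"
    and E_proper: "\<And>y'. proper_fun (E y')"
    and E_lsc: "\<And>y'. weakly_lsc (E y')"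
    and E_convex: "\<And>y'. convex_fun (E y')"
    and feasible: "proper_fun (\<lambda>x. E y (H *v x))"
  shows "(\<exists>!s. is_arg_min (regularized_cost E y H lam p) (\<lambda>_. True) s) \<and>
    (\<forall>s. is_arg_min (regularized_cost E y H lam p) (\<lambda>_. True) s \<longrightarrow>
      (\<exists>a :: real ^ 'm.
        (\<forall>n. s $ n = \<bar>(transpose H *v a) $ n\<bar> powr (q - 1)
                      / lp_norm q (transpose H *v a) powr (q - 2)
                      * sgn ((transpose H *v a) $ n)) \<and>
        (p = 2 \<longrightarrow> s = transpose H *v a \<and>
                   transpose H *v a = (\<Sum>m\<in>UNIV. (a $ m) *\<^sub>R h m) \<and>
                   s \<in> span (range h))))"
proof (intro conjI allI impI)
  let ?F = "regularized_cost E y H lam p"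
  have arg_min: "is_arg_min ?F (\<lambda>_. True) s \<longleftrightarrow> (\<forall>z. ?F s \<le> ?F z)" for s
    by (auto simp: is_arg_min_def not_less)
  obtain x0 where "E y (H *v x0) \<noteq> \<infinity>" using feasible by (auto simp: proper_fun_def)
  then have "?F x0 \<noteq> top" by (simp add: regularized_cost_def)
  \<comment> \<open>A minimal value is at most the finite cost of the feasible point
    \<open>x0\<close>.\<close>
  then have finite: "?F s \<noteq> top" if "\<And>z. ?F s \<le> ?F z" for s
    using that[of x0] by (auto simp: top_unique)
  show "\<exists>!s. is_arg_min ?F (\<lambda>_. True) s"
    unfolding arg_min
    using regularized_cost_attains_min[where E = E and y = y and H = H, OF p lam E_lsc feasible]
      regularized_cost_min_unique[where E = E and y = y, OF p lam E_convex] finite by metis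
  fix s assume "is_arg_min ?F (\<lambda>_. True) s"
  then have s: "?F s \<le> ?F z" for z by (simp add: arg_min)
  let ?g = "\<chi> n. \<bar>s $ n\<bar> powr (p - 1) * sgn (s $ n)"
  obtain b where b: "?g = transpose H *v b"
    using regularized_cost_min_gradient[where E = E and y = y, OF p lam finite[OF s] s] by blast
  \<comment> \<open>The scalar is absorbed into \<open>a\<close>, so that
    \<open>transpose H *v a\<close> becomes the vector \<open>u\<close> of
    \<open>duality_map_scaled_gradient\<close>.\<close>
  define a where "a = lp_norm q ?g powr (q - 2) *\<^sub>R b"
  have "transpose H *v a = lp_norm q ?g powr (q - 2) *\<^sub>R ?g"
    unfolding a_def b by (simp add: matrix_vector_mult_scaleR)
  note repr = duality_map_scaled_gradient[OF p q refl this]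
  have Ha: "transpose H *v a = (\<Sum>m\<in>UNIV. (a $ m) *\<^sub>R h m)"
    by (simp add: H vec_eq_iff matrix_vector_mult_def transpose_def mult.commute)
  have s2: "s = transpose H *v a" if "p = 2"
  proof -
    have "q = 2" using q that by (cases "q = 0") (auto simp: field_simps)
    \<comment> \<open>For \<open>q = 2\<close> the denominator has exponent 0: it is 1 for a nonzero
      norm, but \<open>0 powr 0 = 0\<close>, so the zero vector is treated separately.\<close>
    show ?thesis
    proof (cases "transpose H *v a = 0")
      case True
      then show ?thesis using repr by (simp add: vec_eq_iff)
    next
      case False
      have "lp_norm q (transpose H *v a) \<noteq> 0" using lp_norm_pos[OF False, of q] by simp
      then show ?thesis using repr \<open>q = 2\<close> by (simp add: vec_eq_iff abs_mult_sgn)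
    qed
  qed
  have "(\<Sum>m\<in>UNIV. (a $ m) *\<^sub>R h m) \<in> span (range h)"
    by (intro span_sum span_scale span_base) auto
  then show "\<exists>a :: real ^ 'm.
        (\<forall>n. s $ n = \<bar>(transpose H *v a) $ n\<bar> powr (q - 1)
                      / lp_norm q (transpose H *v a) powr (q - 2)
                      * sgn ((transpose H *v a) $ n)) \<and>
        (p = 2 \<longrightarrow> s = transpose H *v a \<and>
                   transpose H *v a = (\<Sum>m\<in>UNIV. (a $ m) *\<^sub>R h m) \<and>
                   s \<in> span (range h))"
    using repr s2 Ha by (intro exI[of _ a]) auto
qed

end
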